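(* There is an absolute constant $c\le\left(\frac{2}{\pi}+2\right)^3$ such that the following holds. Let $X\in\mathbb{R}^{r\times d}$ be an arbitrary matrix, let $\epsilon>0$, $\delta\in(0,1)$, and let $n\ge1$ be an integer. Let $\lambda_n^2$ be the estimate of $\|X\|^2$ obtained after $n$ power iterations started from a random isotropic unit vector $x_0$ (as defined in the context). Then with probability at least $1-\delta$, $$\lambda_n^2\ge\frac{\|X\|^2(1-\epsilon)}{\sqrt{1+\frac{cd}{\delta^3}(1-\epsilon)^{2(n+1)}}}.$$
   Context: $\|\cdot\|$ is the spectral norm for matrices and the Euclidean norm for vectors. The starting vector is $x_0=[z_1,\ldots,z_d]^{T}/\sqrt{z_1^2+\cdots+z_d^2}$, where $z_1,\ldots,z_d$ are independent standard normal random variables. For $n\ge1$, $x_n=X^{T}Xx_{n-1}/\|X^{T}Xx_{n-1}\|$ (for $X\neq0$ this is almost surely well defined; if $X=0$, put $x_n=x_0$). The estimate after $n$ iterations is $\lambda_n^2=\|X^{T}Xx_n\|$. The probability is over the random choice of $x_0$. *)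

theory Defs
  imports "HOL-Probability.Probability" "Jordan_Normal_Form.Matrix"
begin

definition euclid_norm :: "real vec \<Rightarrow> real" where
  "euclid_norm v = L2_set (vec_index v) {..<dim_vec v}"

text \<open>The operator norm induced by the Euclidean norm. The dimensions are quantified inside the
  theorem, so matrices live in explicit carriers and \<^const>\<open>onorm\<close> is not applicable.\<close>

definition spectral_norm :: "real mat \<Rightarrow> real" where
  "spectral_norm A =
     (SUP v\<in>{v \<in> carrier_vec (dim_col A). euclid_norm v \<le> 1}. euclid_norm (A *\<^sub>v v))"

definition normalized_vec :: "real vec \<Rightarrow> real vec" where
  "normalized_vec v = (1 / euclid_norm v) \<cdot>\<^sub>v v"

text \<open>Outside a null set of starting vectors the normalization never divides by zero, unless
  \<^term>\<open>X\<close> is the zero matrix, for which the iteration stays at the starting vector.\<close>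

primrec power_iter :: "real mat \<Rightarrow> real vec \<Rightarrow> nat \<Rightarrow> real vec" where
  "power_iter X x\<^sub>0 0 = x\<^sub>0"
| "power_iter X x\<^sub>0 (Suc n) =
     (if X = 0\<^sub>m (dim_row X) (dim_col X) then x\<^sub>0
      else normalized_vec ((transpose_mat X * X) *\<^sub>v power_iter X x\<^sub>0 n))"

text \<open>The estimate of the squared spectral norm, not of the norm itself.\<close>

definition power_estimate :: "real mat \<Rightarrow> real vec \<Rightarrow> nat \<Rightarrow> real" where
  "power_estimate X x\<^sub>0 n = euclid_norm ((transpose_mat X * X) *\<^sub>v power_iter X x\<^sub>0 n)"

text \<open>The joint law of \<open>d\<close> independent standard normal variables, as the canonical probability
  space whose coordinate functions are these variables.\<close>

definition std_gaussian :: "nat \<Rightarrow> (nat \<Rightarrow> real) measure" where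
  "std_gaussian d = (\<Pi>\<^sub>M i\<in>{..<d}. density lborel std_normal_density)"

definition start_vec :: "nat \<Rightarrow> (nat \<Rightarrow> real) \<Rightarrow> real vec" where
  "start_vec d z = vec d (\<lambda>i. z i / sqrt (\<Sum>j<d. (z j)\<^sup>2))"

lemma prob_space_std_gaussian: "prob_space (std_gaussian d)"
  unfolding std_gaussian_def by (intro prob_space_PiM prob_space_normal_density) simp

lemma std_gaussian_coordinate_normal:
  assumes "i < d"
  shows "distributed (std_gaussian d) lborel (\<lambda>z. z i) std_normal_density"
proof -
  have "distr (std_gaussian d) (density lborel std_normal_density) (\<lambda>z. z i)
      = density lborel std_normal_density"
    unfolding std_gaussian_def
    by (rule distr_PiM_component) (use assms in \<open>auto intro!: prob_space_normal_density\<close>)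
  moreover have "distr (std_gaussian d) lborel (\<lambda>z. z i)
      = distr (std_gaussian d) (density lborel std_normal_density) (\<lambda>z. z i)"
    by (rule distr_cong) auto
  moreover have "(\<lambda>z. z i) \<in> measurable (std_gaussian d) lborel"
    unfolding std_gaussian_def using assms
    by (subst measurable_cong_sets[where M' = "\<Pi>\<^sub>M i\<in>{..<d}. borel" and N' = borel])
      (auto intro!: sets_PiM_cong)
  ultimately show ?thesis
    by (simp add: distributed_def)
qed

lemma std_gaussian_coordinates_indep:
  assumes "0 < d"
  shows "prob_space.indep_vars (std_gaussian d) (\<lambda>_. borel) (\<lambda>i z. z i) {..<d}"
proof -
  interpret prob_space "std_gaussian d"
    by (rule prob_space_std_gaussian)
  have normal: "prob_space (density lborel std_normal_density)"
    by (rule prob_space_normal_density) simp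
  have rv: "random_variable borel (\<lambda>z. z i)" if "i \<in> {..<d}" for i
    using std_gaussian_coordinate_normal[of i d] that by (simp add: distributed_def)
  have marg: "distr (std_gaussian d) borel (\<lambda>z. z i) = density lborel std_normal_density"
    if "i \<in> {..<d}" for i
  proof -
    have "distr (std_gaussian d) borel (\<lambda>z. z i) = distr (std_gaussian d) lborel (\<lambda>z. z i)"
      by (rule distr_cong) auto
    then show ?thesis
      using std_gaussian_coordinate_normal[of i d] that by (simp add: distributed_def)
  qed
  have "distr (std_gaussian d) (\<Pi>\<^sub>M i\<in>{..<d}. borel) (\<lambda>z. \<lambda>i\<in>{..<d}. z i)
      = distr (std_gaussian d) (std_gaussian d) (\<lambda>z. z)"
    by (rule distr_cong)
      (auto simp: std_gaussian_def space_PiM PiE_def extensional_restrict restrict_def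
        fun_eq_iff extensional_def intro!: sets_PiM_cong)
  also have "\<dots> = (\<Pi>\<^sub>M i\<in>{..<d}. density lborel std_normal_density)"
    by (simp add: distr_id std_gaussian_def)
  also have "\<dots> = (\<Pi>\<^sub>M i\<in>{..<d}. distr (std_gaussian d) borel (\<lambda>z. z i))"
    by (rule PiM_cong) (simp_all add: marg)
  finally show ?thesis
    using assms rv by (subst indep_vars_iff_distr_eq_PiM') auto
qed

end

theory Submission
  imports Defs
begin

text \<open>Put \<open>A = X\<^sup>T X\<close>. By Cauchy-Schwarz the norms \<open>a\<^sub>k = \<parallel>A^k z\<parallel>\<close> are logarithmically convex, so the
  ratios \<open>a\<^sub>k\<^sub>+\<^sub>1 / a\<^sub>k\<close> increase and the estimate \<open>\<rho> = a\<^sub>n\<^sub>+\<^sub>1 / a\<^sub>n\<close> satisfies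
  \<open>\<rho>^(n+1) \<ge> a\<^sub>n\<^sub>+\<^sub>1 / \<parallel>z\<parallel>\<close>; this replaces a spectral decomposition. For a unit vector \<open>v\<close> almost
  attaining the spectral norm, \<open>a\<^sub>n\<^sub>+\<^sub>1 \<ge> \<bar>\<langle>z, w\<rangle>\<bar>\<close> with \<open>w = A^(n+1) v\<close>, and the same convexity gives
  \<open>\<parallel>w\<parallel> \<ge> \<parallel>X v\<parallel>^(2(n+1))\<close>. Finally \<open>\<langle>z, w\<rangle> / \<parallel>w\<parallel>\<close> is standard normal, hence below \<open>\<delta>/2\<close> in absolute
  value with probability at most \<open>\<delta>/2\<close>, and \<open>\<parallel>z\<parallel>\<^sup>2 > 2d/\<delta>\<close> has probability at most \<open>\<delta>/2\<close> by Markov's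
  inequality. This gives the constant \<open>8\<close>, and \<open>12\<close> after allowing for \<open>v\<close> being only almost
  optimal.\<close>

unbundle no inner_syntax and no vec_syntax

section \<open>Logarithmically convex sequences\<close>

locale log_convex_seq =
  fixes a :: "nat \<Rightarrow> real"
  assumes pos: "\<And>k. 0 < a k"
    and log_convex: "\<And>k. (a (Suc k))\<^sup>2 \<le> a k * a (Suc (Suc k))"
begin

definition ratio :: "nat \<Rightarrow> real" where
  "ratio k = a (Suc k) / a k"

lemma Suc_eq: "a (Suc k) = ratio k * a k"
  using pos[of k] by (simp add: ratio_def)

lemma ratio_pos: "0 < ratio k"
  using pos by (simp add: ratio_def)

lemma mono_ratio: "mono ratio"
proof (rule incseq_SucI)
  fix k
  show "ratio k \<le> ratio (Suc k)"
    using log_convex[of k] pos[of k] pos[of "Suc k"]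
    by (simp add: ratio_def field_simps power2_eq_square)
qed

text \<open>\<open>a k / a 0\<close> telescopes into a product of \<open>k\<close> consecutive
  ratios, of which \<open>ratio 0\<close> is the smallest.\<close>

lemma first_ratio_power_le: "ratio 0 ^ k * a 0 \<le> a k"
proof (induction k)
  case (Suc k)
  have "ratio 0 ^ Suc k * a 0 = ratio 0 * (ratio 0 ^ k * a 0)"
    by simp
  also have "\<dots> \<le> ratio k * a k"
    using Suc monoD[OF mono_ratio, of 0 k] ratio_pos pos
    by (intro mult_mono) (auto simp: less_imp_le)
  finally show ?case
    by (simp add: Suc_eq)
qed simp

text \<open>The same telescoping, estimated by the largest factor: \<open>k \<le> Suc n\<close>
  ensures that the ratios in the product have indices up to \<open>n\<close> only.\<close>

lemma le_last_ratio_power: "k \<le> Suc n \<Longrightarrow> a k \<le> ratio n ^ k * a 0"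
proof (induction k)
  case (Suc k)
  then have "ratio k * a k \<le> ratio n * (ratio n ^ k * a 0)"
    using monoD[OF mono_ratio, of k n] ratio_pos pos
    by (intro mult_mono) (auto simp: less_imp_le)
  then show ?case
    by (simp add: Suc_eq)
qed simp

end

text \<open>A zero next to \<open>a (Suc j)\<close> would force \<open>a (Suc j) = 0\<close>, so
  positivity spreads to both neighbours. The starting index is a successor because the sequence 1,
  0, 0, ... is also nonnegative and log-convex. For iterates this rules out division by
  zero.\<close>

lemma log_convex_pos:
  fixes a :: "nat \<Rightarrow> real"
  assumes nonneg: "\<And>k. 0 \<le> a k"
    and log_convex: "\<And>k. (a (Suc k))\<^sup>2 \<le> a k * a (Suc (Suc k))"
    and m: "0 < a (Suc m)"
  shows "0 < a k"
proof -
  have neighbours: "a j \<noteq> 0 \<and> a (Suc (Suc j)) \<noteq> 0" if "a (Suc j) \<noteq> 0" for j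
    using log_convex[of j] that by auto
  \<comment> \<open>Subtraction is truncated, so for \<open>i > m\<close> the index stays at 0 and
    the claim merely repeats itself.\<close>
  have down: "a (Suc m - i) \<noteq> 0" for i
  proof (induction i)
    case (Suc i)
    show ?case
    proof (cases "i \<le> m")
      case True
      then show ?thesis
        using Suc neighbours[of "m - i"] by (simp add: Suc_diff_le)
    qed (use Suc in \<open>simp add: not_le\<close>)
  qed (use m in simp)
  have up: "a (Suc m + i) \<noteq> 0" for i
  proof (induction i)
    case (Suc i)
    then show ?case
      using neighbours[of "m + i"] by simp
  qed (use m in simp)
  have "a k \<noteq> 0"
  proof (cases "k \<le> Suc m")
    case True
    then show ?thesis
      using down[of "Suc m - k"] by simp
  next
    case False
    then show ?thesis
      using up[of "k - Suc m"] by simp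
  qed
  with nonneg[of k] show ?thesis
    by linarith
qed

section \<open>Euclidean norm and iterates of a symmetric matrix\<close>

lemma euclid_norm_sq: "(euclid_norm v)\<^sup>2 = v \<bullet> v"
  by (simp add: euclid_norm_def L2_set_def sum_nonneg scalar_prod_def power2_eq_square
      atLeast0LessThan)

lemma euclid_norm_nonneg: "0 \<le> euclid_norm v"
  by (simp add: euclid_norm_def)

lemma euclid_norm_smult: "euclid_norm (c \<cdot>\<^sub>v v) = \<bar>c\<bar> * euclid_norm v"
  by (rule power2_eq_imp_eq)
    (simp_all add: euclid_norm_sq euclid_norm_nonneg power_mult_distrib,
      simp add: power2_eq_square)

lemma scalar_prod_le_euclid_norm:
  assumes "u \<in> carrier_vec n" "v \<in> carrier_vec n"
  shows "\<bar>u \<bullet> v\<bar> \<le> euclid_norm u * euclid_norm v"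
proof -
  have "\<bar>u \<bullet> v\<bar> \<le> (\<Sum>i<dim_vec v. \<bar>u $ i\<bar> * \<bar>v $ i\<bar>)"
    unfolding scalar_prod_def atLeast0LessThan abs_mult[symmetric] by (rule sum_abs)
  also have "\<dots> \<le> euclid_norm u * euclid_norm v"
    using L2_set_mult_ineq[of "vec_index u" "vec_index v" "{..<n}"] assms
    by (simp add: euclid_norm_def)
  finally show ?thesis .
qed

lemma mult_mat_vec_smult:
  fixes A :: "'a :: comm_semiring_0 mat"
  assumes "A \<in> carrier_mat m n" "v \<in> carrier_vec n"
  shows "A *\<^sub>v (c \<cdot>\<^sub>v v) = c \<cdot>\<^sub>v (A *\<^sub>v v)"
  using assms by (intro eq_vecI) auto

locale symmetric_mat =
  fixes A :: "real mat" and d :: nat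
  assumes carrier: "A \<in> carrier_mat d d"
    and symmetric: "transpose_mat A = A"
begin

definition iterate :: "real vec \<Rightarrow> nat \<Rightarrow> real vec" where
  "iterate v k = ((*\<^sub>v) A ^^ k) v"

lemma iterate_0 [simp]: "iterate v 0 = v"
  by (simp add: iterate_def)

lemma iterate_Suc [simp]: "iterate v (Suc k) = A *\<^sub>v iterate v k"
  by (simp add: iterate_def)

lemma iterate_carrier: "v \<in> carrier_vec d \<Longrightarrow> iterate v k \<in> carrier_vec d"
  using carrier by (induction k) auto

lemma self_adjoint:
  assumes "u \<in> carrier_vec d" "v \<in> carrier_vec d"
  shows "(A *\<^sub>v u) \<bullet> v = u \<bullet> (A *\<^sub>v v)"
  using transpose_vec_mult_scalar[OF carrier assms(2,1)] symmetric by simp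

lemma iterate_self_adjoint:
  assumes "u \<in> carrier_vec d" "v \<in> carrier_vec d"
  shows "iterate u k \<bullet> v = u \<bullet> iterate v k"
  using assms
proof (induction k arbitrary: v)
  case (Suc k)
  have "iterate u (Suc k) \<bullet> v = iterate u k \<bullet> (A *\<^sub>v v)"
    using self_adjoint[OF iterate_carrier[OF Suc.prems(1)] Suc.prems(2)] by simp
  also have "\<dots> = u \<bullet> iterate (A *\<^sub>v v) k"
    using Suc carrier by simp
  also have "iterate (A *\<^sub>v v) k = iterate v (Suc k)"
    by (simp add: iterate_def funpow_swap1)
  finally show ?case .
qed simp

text \<open>Symmetry moves one factor \<open>A\<close> across the inner product, which turns the
  square into a product of the two neighbouring iterates, ready for Cauchy-Schwarz.\<close>

lemma log_convex_iterate:
  assumes "v \<in> carrier_vec d"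
  shows "(euclid_norm (iterate v (Suc k)))\<^sup>2
    \<le> euclid_norm (iterate v k) * euclid_norm (iterate v (Suc (Suc k)))"
proof -
  have "(euclid_norm (iterate v (Suc k)))\<^sup>2 = iterate v k \<bullet> iterate v (Suc (Suc k))"
    using self_adjoint[OF iterate_carrier[OF assms, of k] iterate_carrier[OF assms, of "Suc k"]]
    by (simp add: euclid_norm_sq)
  also have "\<dots> \<le> euclid_norm (iterate v k) * euclid_norm (iterate v (Suc (Suc k)))"
    using scalar_prod_le_euclid_norm[OF iterate_carrier[OF assms] iterate_carrier[OF assms],
        of k "Suc (Suc k)"]
    by linarith
  finally show ?thesis .
qed

lemma log_convex_seq_iterate:
  assumes "v \<in> carrier_vec d" "0 < euclid_norm (iterate v (Suc m))"
  shows "log_convex_seq (\<lambda>k. euclid_norm (iterate v k))"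
proof -
  have "0 < euclid_norm (iterate v k)" for k
    using euclid_norm_nonneg log_convex_iterate[OF assms(1)] assms(2)
    by (rule log_convex_pos[where a = "\<lambda>k. euclid_norm (iterate v k)"])
  then show ?thesis
    by unfold_locales (simp_all only: log_convex_iterate assms)
qed

end

lemma symmetric_gram:
  assumes "X \<in> carrier_mat r d"
  shows "symmetric_mat (transpose_mat X * X) d"
  using assms by unfold_locales (simp_all add: transpose_mult[of _ d r _ d])

lemma gram_scalar_prod:
  fixes X :: "real mat"
  assumes "X \<in> carrier_mat r d" "u \<in> carrier_vec d" "v \<in> carrier_vec d"
  shows "((transpose_mat X * X) *\<^sub>v u) \<bullet> v = (X *\<^sub>v u) \<bullet> (X *\<^sub>v v)"
proof -
  have "(transpose_mat X * X) *\<^sub>v u = transpose_mat X *\<^sub>v (X *\<^sub>v u)"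
    using assms by (intro assoc_mult_mat_vec) auto
  then show ?thesis
    using transpose_vec_mult_scalar[OF assms(1,3), of "X *\<^sub>v u"] assms by simp
qed

section \<open>The spectral norm\<close>

text \<open>Needed because a real supremum is meaningful only over a bounded set. Cauchy-Schwarz
  bounds each coordinate of \<open>X *\<^sub>v v\<close> by the norm of the corresponding
  row.\<close>

lemma spectral_norm_bdd_above:
  "bdd_above ((\<lambda>v. euclid_norm (X *\<^sub>v v)) ` {v \<in> carrier_vec (dim_col X). euclid_norm v \<le> 1})"
proof (rule bdd_aboveI2)
  fix v
  assume v: "v \<in> {v \<in> carrier_vec (dim_col X). euclid_norm v \<le> 1}"
  have "\<bar>(X *\<^sub>v v) $ i\<bar> \<le> euclid_norm (row X i)" if "i < dim_row X" for i
  proof -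
    have "\<bar>row X i \<bullet> v\<bar> \<le> euclid_norm (row X i) * euclid_norm v"
      using v by (intro scalar_prod_le_euclid_norm[of _ "dim_col X"]) auto
    also have "\<dots> \<le> euclid_norm (row X i)"
      using v euclid_norm_nonneg[of "row X i"] by (simp add: mult_left_le)
    finally show ?thesis
      using that by simp
  qed
  then have "(\<Sum>i<dim_row X. \<bar>(X *\<^sub>v v) $ i\<bar>) \<le> (\<Sum>i<dim_row X. euclid_norm (row X i))"
    by (intro sum_mono) simp
  moreover have "euclid_norm (X *\<^sub>v v) \<le> (\<Sum>i<dim_row X. \<bar>(X *\<^sub>v v) $ i\<bar>)"
    unfolding euclid_norm_def by (rule order_trans[OF L2_set_le_sum_abs]) simp
  ultimately show "euclid_norm (X *\<^sub>v v) \<le> (\<Sum>i<dim_row X. euclid_norm (row X i))"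
    by linarith
qed

lemma spectral_norm_nonneg: "0 \<le> spectral_norm X"
proof -
  have "0\<^sub>v (dim_col X) \<in> {v \<in> carrier_vec (dim_col X). euclid_norm v \<le> 1}"
    by (simp add: euclid_norm_def L2_set_def)
  from cSUP_upper[OF this spectral_norm_bdd_above]
  show ?thesis
    using euclid_norm_nonneg[of "X *\<^sub>v 0\<^sub>v (dim_col X)"]
    unfolding spectral_norm_def by (rule order_trans[rotated])
qed

text \<open>Staying strictly below the supremum avoids a compactness argument for a
  maximizer.\<close>

lemma spectral_norm_witness:
  assumes "X \<in> carrier_mat r d" "t < spectral_norm X"
  obtains v where "v \<in> carrier_vec d" "euclid_norm v \<le> 1" "t < euclid_norm (X *\<^sub>v v)"
proof -
  have "0\<^sub>v (dim_col X) \<in> {v \<in> carrier_vec (dim_col X). euclid_norm v \<le> 1}"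
    by (simp add: euclid_norm_def L2_set_def)
  then have "\<exists>y\<in>(\<lambda>v. euclid_norm (X *\<^sub>v v)) ` {v \<in> carrier_vec (dim_col X). euclid_norm v \<le> 1}. t < y"
    using assms(2) unfolding spectral_norm_def by (intro less_cSupD) blast+
  then show ?thesis
    using that assms(1) by auto
qed

section \<open>Deterministic analysis of power iteration\<close>

text \<open>The quadratic form of the Gram matrix at \<open>v\<close> is the squared norm of
  \<open>X *\<^sub>v v\<close>, so \<open>t\<^sup>2 < a 1 * a 0\<close>. As
  \<open>a 0 \<le> 1\<close>, this bounds the first ratio below by \<open>t\<^sup>2\<close>, and all
  later ratios are larger still.\<close>

lemma gram_iterate_lower_bound:
  assumes X: "X \<in> carrier_mat r d" and v: "v \<in> carrier_vec d" "euclid_norm v \<le> 1"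
    and t: "0 \<le> t" "t < euclid_norm (X *\<^sub>v v)"
  shows "t ^ (2 * Suc k) \<le> euclid_norm (symmetric_mat.iterate (transpose_mat X * X) v (Suc k))"
proof -
  interpret symmetric_mat "transpose_mat X * X" d
    by (rule symmetric_gram[OF X])
  define a where "a k = euclid_norm (iterate v k)" for k
  have "t\<^sup>2 < (euclid_norm (X *\<^sub>v v))\<^sup>2"
    using t by (intro power_strict_mono) auto
  also have "\<dots> = iterate v 1 \<bullet> v"
    using gram_scalar_prod[OF X v(1) v(1)] by (simp add: euclid_norm_sq)
  also have "\<dots> \<le> a 1 * a 0"
    using scalar_prod_le_euclid_norm[OF iterate_carrier[OF v(1)] v(1), of 1]
    by (simp add: a_def)
  finally have step: "t\<^sup>2 < a 1 * a 0" .
  have a0: "a 0 \<le> 1" "0 \<le> a 0" "0 \<le> a 1"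
    using v(2) euclid_norm_nonneg by (simp_all add: a_def)
  have "0 < a 1 * a 0"
    using step zero_le_power2[of t] by linarith
  then have a1: "0 < a (Suc 0)"
    using a0 by (simp add: zero_less_mult_iff)
  then interpret a: log_convex_seq a
    using log_convex_seq_iterate[OF v(1)] unfolding a_def by blast
  have "a 1 * a 0 \<le> a 1"
    using a0 by (simp add: mult_left_le)
  also have "a 1 \<le> a.ratio 0"
    using a0 a.pos[of 0] a.pos[of 1] by (simp add: a.ratio_def pos_le_divide_eq mult_left_le)
  finally have "t\<^sup>2 \<le> a.ratio 0"
    using step by simp
  \<comment> \<open>One factor \<open>t\<^sup>2\<close> is kept apart and bounded by
    \<open>a 1 * a 0\<close>: estimating all of them by \<open>a.ratio 0\<close> would leave no room
    for the factor \<open>a 0\<close>, which may be below 1.\<close>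
  have "t ^ (2 * Suc k) = (t\<^sup>2) ^ k * t\<^sup>2"
    by (simp only: power_mult power_Suc2)
  also have "\<dots> \<le> a.ratio 0 ^ k * (a 1 * a 0)"
    using \<open>t\<^sup>2 \<le> a.ratio 0\<close> step a.ratio_pos[of 0] by (intro mult_mono power_mono) auto
  also have "\<dots> \<le> a.ratio 0 ^ k * (a.ratio 0 * a 0)"
    using \<open>a 1 * a 0 \<le> a 1\<close> a.Suc_eq[of 0] a.ratio_pos[of 0] by (intro mult_left_mono) auto
  also have "\<dots> = a.ratio 0 ^ Suc k * a 0"
    by simp
  also have "\<dots> \<le> a (Suc k)"
    by (rule a.first_ratio_power_le)
  finally show ?thesis
    by (simp only: a_def)
qed

text \<open>By linearity, normalizing after every step has the same effect as normalizing once at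
  the end; the estimate applies the Gram matrix one more time.\<close>

lemma power_estimate_eq_ratio:
  assumes X: "X \<in> carrier_mat r d" "X \<noteq> 0\<^sub>m r d" and v: "v \<in> carrier_vec d"
    and pos: "\<And>k. 0 < euclid_norm (symmetric_mat.iterate (transpose_mat X * X) v k)"
  shows "power_estimate X (normalized_vec v) n
    = euclid_norm (symmetric_mat.iterate (transpose_mat X * X) v (Suc n))
      / euclid_norm (symmetric_mat.iterate (transpose_mat X * X) v n)"
proof -
  let ?A = "transpose_mat X * X"
  interpret symmetric_mat ?A d
    by (rule symmetric_gram[OF X(1)])
  have nonzero: "X \<noteq> 0\<^sub>m (dim_row X) (dim_col X)"
    using X by auto
  have power_iter: "power_iter X (normalized_vec v) k = normalized_vec (iterate v k)" for k
  proof (induction k)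
    case (Suc k)
    have "power_iter X (normalized_vec v) (Suc k)
        = normalized_vec (?A *\<^sub>v normalized_vec (iterate v k))"
      by (simp only: power_iter.simps if_not_P[OF nonzero] Suc)
    also have "?A *\<^sub>v normalized_vec (iterate v k)
        = (1 / euclid_norm (iterate v k)) \<cdot>\<^sub>v iterate v (Suc k)"
      using mult_mat_vec_smult[OF carrier iterate_carrier[OF v]] by (simp add: normalized_vec_def)
    also have "normalized_vec \<dots> = normalized_vec (iterate v (Suc k))"
      using pos[of k] pos[of "Suc k"]
      by (simp add: normalized_vec_def euclid_norm_smult smult_smult_assoc)
    finally show ?case .
  qed simp
  have "power_estimate X (normalized_vec v) n
      = euclid_norm ((1 / euclid_norm (iterate v n)) \<cdot>\<^sub>v iterate v (Suc n))"
    using mult_mat_vec_smult[OF carrier iterate_carrier[OF v]]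
    by (simp add: power_estimate_def power_iter) (simp add: normalized_vec_def)
  then show ?thesis
    using pos[of n] by (simp add: euclid_norm_smult)
qed

text \<open>With \<open>p = \<rho>\<^sup>2\<close> and \<open>y = (L (1 - \<epsilon>))\<^sup>2\<close>, either \<open>p \<ge> y\<close> already, or cancelling \<open>p ^ n\<close> from
  \<open>K p ^ m s ^ m \<ge> y ^ m \<ge> y p ^ n\<close> gives \<open>K p s ^ m \<ge> y\<close>.\<close>

lemma estimate_ge_of_power_bound:
  fixes \<rho> L K \<epsilon> :: real
  assumes "0 < \<rho>" "0 \<le> L" "0 \<le> K"
    and bound: "L ^ (2 * (n + 1)) \<le> K * \<rho> ^ (2 * (n + 1))"
  shows "L * (1 - \<epsilon>) / sqrt (1 + K * (1 - \<epsilon>) ^ (2 * (n + 1))) \<le> \<rho>"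
proof -
  define s where "s = (1 - \<epsilon>)\<^sup>2"
  define m where "m = n + 1"
  define p where "p = \<rho>\<^sup>2"
  define y where "y = L\<^sup>2 * s"
  have nonneg: "0 \<le> s" "0 < p" "0 \<le> y" "0 \<le> K * s ^ m"
    using assms by (simp_all add: s_def p_def y_def)
  have bound': "(L\<^sup>2) ^ m \<le> K * p ^ m"
    using bound unfolding power_mult m_def p_def .
  have "y \<le> p * (1 + K * s ^ m)"
  proof (cases "y \<le> p")
    case True
    then show ?thesis
      using nonneg mult_left_mono[of 1 "1 + K * s ^ m" p] by linarith
  next
    case False
    have "y * p ^ n \<le> y * y ^ n"
      using False nonneg by (intro mult_left_mono power_mono) auto
    also have "\<dots> = (L\<^sup>2) ^ m * s ^ m"
      by (simp add: m_def y_def power_mult_distrib)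
    also have "\<dots> \<le> K * p ^ m * s ^ m"
      using bound' nonneg by (intro mult_right_mono) auto
    also have "\<dots> = (p * (K * s ^ m)) * p ^ n"
      by (simp add: m_def)
    finally have "y \<le> p * (K * s ^ m)"
      using nonneg by simp
    then show ?thesis
      using nonneg by (simp add: distrib_left)
  qed
  then have "(L * (1 - \<epsilon>))\<^sup>2 \<le> (\<rho> * sqrt (1 + K * s ^ m))\<^sup>2"
    using nonneg by (simp add: power_mult_distrib y_def s_def p_def)
  \<comment> \<open>Passing from squares to the numbers requires only a nonnegative right side, so
    the case \<open>\<epsilon> > 1\<close> with a negative left side is covered.\<close>
  then have "L * (1 - \<epsilon>) \<le> \<rho> * sqrt (1 + K * s ^ m)"
    by (rule power2_le_imp_le) (use assms nonneg in simp)
  moreover have "s ^ m = (1 - \<epsilon>) ^ (2 * (n + 1))"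
    by (simp only: s_def m_def power_mult)
  ultimately show ?thesis
    using nonneg by (simp only: pos_divide_le_eq real_sqrt_gt_zero add_pos_nonneg zero_less_one)
qed

text \<open>The supremum defining the spectral norm need not be attained by \<open>v\<close>; the factor \<open>2 / 3\<close>
  accounts for that.\<close>

lemma power_estimate_ge:
  assumes X: "X \<in> carrier_mat r d" "0 < spectral_norm X"
    and v: "v \<in> carrier_vec d" "euclid_norm v \<le> 1"
    and t: "0 < t" "t < euclid_norm (X *\<^sub>v v)"
      "2 / 3 * spectral_norm X ^ (4 * (n + 1)) \<le> t ^ (4 * (n + 1))"
    and z: "z \<in> carrier_vec d" "(euclid_norm z)\<^sup>2 \<le> M"
    and w: "w = symmetric_mat.iterate (transpose_mat X * X) v (n + 1)"
    and g: "0 < g" "g * euclid_norm w \<le> \<bar>z \<bullet> w\<bar>"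
    and K: "3 / 2 * M / g\<^sup>2 \<le> K"
  shows "(spectral_norm X)\<^sup>2 * (1 - \<epsilon>) / sqrt (1 + K * (1 - \<epsilon>) ^ (2 * (n + 1)))
    \<le> power_estimate X (normalized_vec z) n"
proof -
  interpret symmetric_mat "transpose_mat X * X" d
    by (rule symmetric_gram[OF X(1)])
  define S where "S = spectral_norm X"
  define a where "a k = euclid_norm (iterate z k)" for k
  have S: "0 < S"
    using X by (simp add: S_def)
  have "X \<noteq> 0\<^sub>m r d"
  proof
    assume "X = 0\<^sub>m r d"
    then have "X *\<^sub>v v = 0\<^sub>v r"
      using v by auto
    then show False
      using t by (simp add: euclid_norm_def L2_set_def)
  qed
  have "t ^ (2 * (n + 1)) \<le> euclid_norm w"
    using gram_iterate_lower_bound[OF X(1) v, of t n] t by (simp add: w)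
  then have "g * t ^ (2 * (n + 1)) \<le> g * euclid_norm w"
    using g by simp
  also have "\<dots> \<le> \<bar>iterate z (n + 1) \<bullet> v\<bar>"
    using g iterate_self_adjoint[OF z(1) v(1), of "n + 1"] by (simp add: w)
  also have "\<dots> \<le> a (n + 1) * euclid_norm v"
    unfolding a_def by (rule scalar_prod_le_euclid_norm[OF iterate_carrier[OF z(1)] v(1)])
  also have "\<dots> \<le> a (n + 1)"
    using v euclid_norm_nonneg by (simp add: a_def mult_left_le)
  finally have lower: "g * t ^ (2 * (n + 1)) \<le> a (n + 1)" .
  have "0 < g * t ^ (2 * (n + 1))"
    using g t by simp
  with lower have "0 < a (Suc n)"
    by simp
  then interpret a: log_convex_seq a
    using log_convex_seq_iterate[OF z(1)] unfolding a_def by blast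
  define \<rho> where "\<rho> = a.ratio n"
  have estimate: "power_estimate X (normalized_vec z) n = \<rho>"
    using power_estimate_eq_ratio[OF X(1) \<open>X \<noteq> 0\<^sub>m r d\<close> z(1), of n] a.pos
    by (simp add: a_def \<rho>_def a.ratio_def)
  have double: "2 * (n + 1) * 2 = 4 * (n + 1)"
    by simp
  \<comment> \<open>Squaring brings in \<open>M\<close>, the bound on the squared norm of
    \<open>z\<close>, and produces the exponent \<open>4 * (n + 1)\<close> for which
    \<open>t\<close> is calibrated.\<close>
  have "(g * t ^ (2 * (n + 1)))\<^sup>2 \<le> (\<rho> ^ (n + 1) * a 0)\<^sup>2"
    using lower a.le_last_ratio_power[of "n + 1" n] g t
    by (intro power_mono) (auto simp: \<rho>_def)
  also have "\<dots> = \<rho> ^ (2 * (n + 1)) * (a 0)\<^sup>2"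
    unfolding power_mult_distrib power_mult[symmetric] by (simp only: mult.commute)
  also have "\<dots> \<le> \<rho> ^ (2 * (n + 1)) * M"
    using z a.ratio_pos[of n] by (intro mult_left_mono) (auto simp: a_def \<rho>_def)
  also have "(g * t ^ (2 * (n + 1)))\<^sup>2 = g\<^sup>2 * t ^ (4 * (n + 1))"
    unfolding power_mult_distrib power_mult[symmetric] double ..
  finally have "g\<^sup>2 * (2 / 3 * S ^ (4 * (n + 1))) \<le> \<rho> ^ (2 * (n + 1)) * M"
    using mult_left_mono[OF t(3) zero_le_power2[of g]] unfolding S_def by linarith
  then have "S ^ (4 * (n + 1)) \<le> (3 / 2 * M / g\<^sup>2) * \<rho> ^ (2 * (n + 1))"
    using g by (simp add: field_simps)
  also have "\<dots> \<le> K * \<rho> ^ (2 * (n + 1))"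
    using K a.ratio_pos[of n] by (intro mult_right_mono) (auto simp: \<rho>_def)
  \<comment> \<open>This is the hypothesis of \<open>estimate_ge_of_power_bound\<close> with
    \<open>L = S\<^sup>2\<close>, since the estimate approximates the squared norm.\<close>
  finally have "(S\<^sup>2) ^ (2 * (n + 1)) \<le> K * \<rho> ^ (2 * (n + 1))"
    unfolding power_mult[symmetric] double[symmetric] by (simp only: mult.commute)
  moreover have "0 \<le> K"
    using order_trans[OF zero_le_power2 z(2)] g
    by (intro order_trans[OF _ K] divide_nonneg_nonneg) auto
  ultimately show ?thesis
    unfolding estimate S_def[symmetric]
    using a.ratio_pos[of n] by (intro estimate_ge_of_power_bound) (auto simp: \<rho>_def)
qed

section \<open>Gaussian vectors\<close>

lemma std_gaussian_measurable_coordinate: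
  "i < d \<Longrightarrow> (\<lambda>z. z i) \<in> borel_measurable (std_gaussian d)"
  using std_gaussian_coordinate_normal[of i d] by (simp add: distributed_def)

lemma std_gaussian_second_moment:
  assumes "i < d"
  shows "has_bochner_integral (std_gaussian d) (\<lambda>z. (z i)\<^sup>2) 1"
proof -
  note D = std_gaussian_coordinate_normal[OF assms]
  have moment: "has_bochner_integral lborel (\<lambda>x. std_normal_density x * x\<^sup>2) 1"
    using std_normal_moment_even[of 1] by simp
  then have "integrable (std_gaussian d) (\<lambda>z. (z i)\<^sup>2)"
    using distributed_integrable[OF D, of "\<lambda>x. x\<^sup>2"] by (auto simp: has_bochner_integral_iff)
  moreover have "(\<integral>z. (z i)\<^sup>2 \<partial>std_gaussian d) = 1"
    using moment distributed_integral[OF D, of "\<lambda>x. x\<^sup>2"] by (auto simp: has_bochner_integral_iff)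
  ultimately show ?thesis
    by (simp add: has_bochner_integral_iff)
qed

lemma std_gaussian_norm_tail:
  assumes "0 < d" "0 < \<eta>"
  shows "measure (std_gaussian d) {z \<in> space (std_gaussian d). d / \<eta> \<le> (\<Sum>i<d. (z i)\<^sup>2)} \<le> \<eta>"
proof -
  have sum: "has_bochner_integral (std_gaussian d) (\<lambda>z. \<Sum>i<d. (z i)\<^sup>2) (\<Sum>i<d. 1)"
    by (intro has_bochner_integral_sum std_gaussian_second_moment) simp
  then have "measure (std_gaussian d) {z \<in> space (std_gaussian d). d / \<eta> \<le> (\<Sum>i<d. (z i)\<^sup>2)}
      \<le> (\<integral>z. (\<Sum>i<d. (z i)\<^sup>2) \<partial>std_gaussian d) / (d / \<eta>)"
    using assms
    by (intro integral_Markov_inequality_measure[where A = "{}"])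
      (auto simp: has_bochner_integral_iff sum_nonneg)
  also have "\<dots> = \<eta>"
    using sum assms by (auto simp: has_bochner_integral_iff)
  finally show ?thesis .
qed

text \<open>The peak of the density is rounded up using \<open>pi \<ge> 2\<close>, so that an
  interval of length \<open>2 * \<eta> * \<sigma>\<close> has mass at most
  \<open>\<eta>\<close>.\<close>

lemma normal_density_le:
  assumes "0 < \<sigma>"
  shows "normal_density \<mu> \<sigma> x \<le> 1 / (2 * \<sigma>)"
proof -
  have "2 * \<sigma> = sqrt (4 * \<sigma>\<^sup>2)"
    using assms by (simp add: real_sqrt_mult)
  also have "\<dots> \<le> sqrt (2 * pi * \<sigma>\<^sup>2)"
    using pi_ge_two by (intro real_sqrt_le_mono mult_right_mono) auto
  finally have "1 / sqrt (2 * pi * \<sigma>\<^sup>2) \<le> 1 / (2 * \<sigma>)"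
    using assms by (intro divide_left_mono) auto
  moreover have "normal_density \<mu> \<sigma> x \<le> 1 / sqrt (2 * pi * \<sigma>\<^sup>2)"
    unfolding normal_density_def by (rule mult_left_le) auto
  ultimately show ?thesis
    by linarith
qed

lemma (in prob_space) normal_small_ball:
  assumes "0 < \<sigma>" "distributed M lborel Y (normal_density \<mu> \<sigma>)" "0 \<le> \<eta>"
  shows "prob {x \<in> space M. \<bar>Y x\<bar> < \<eta> * \<sigma>} \<le> \<eta>"
proof -
  let ?I = "{-(\<eta> * \<sigma>)<..<\<eta> * \<sigma>}"
  have "emeasure M {x \<in> space M. \<bar>Y x\<bar> < \<eta> * \<sigma>} = emeasure M (Y -` ?I \<inter> space M)"
    by (intro arg_cong2[where f = emeasure]) auto
  also have "\<dots> = (\<integral>\<^sup>+x. ennreal (normal_density \<mu> \<sigma> x) * indicator ?I x \<partial>lborel)"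
    by (rule distributed_emeasure[OF assms(2)]) simp
  also have "\<dots> \<le> (\<integral>\<^sup>+x. ennreal (1 / (2 * \<sigma>)) * indicator ?I x \<partial>lborel)"
    using normal_density_le[OF assms(1)] by (intro nn_integral_mono mult_right_mono) (auto intro: ennreal_leI)
  also have "\<dots> = ennreal (1 / (2 * \<sigma>)) * ennreal (2 * (\<eta> * \<sigma>))"
    using assms by (simp add: nn_integral_cmult_indicator)
  also have "\<dots> = ennreal \<eta>"
    using assms by (simp add: ennreal_mult'[symmetric])
  finally show ?thesis
    using assms by (simp add: emeasure_eq_measure)
qed

text \<open>Variances of independent summands add up to the squared norm of \<open>w\<close>, so
  projecting the Gaussian vector needs no rotation.\<close>

lemma std_gaussian_linear_combination:
  assumes d: "0 < d" and w: "w \<in> carrier_vec d" "0 < euclid_norm w"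
  shows "distributed (std_gaussian d) lborel (\<lambda>z. vec d z \<bullet> w) (normal_density 0 (euclid_norm w))"
proof -
  interpret prob_space "std_gaussian d"
    by (rule prob_space_std_gaussian)
  \<comment> \<open>The library only adds normal variables of positive variance.\<close>
  define I where "I = {i \<in> {..<d}. w $ i \<noteq> 0}"
  have I: "finite I" "I \<subseteq> {..<d}"
    by (auto simp: I_def)
  have sq: "(\<Sum>i\<in>I. \<bar>w $ i\<bar>\<^sup>2) = (euclid_norm w)\<^sup>2"
  proof -
    have "(\<Sum>i\<in>I. (w $ i)\<^sup>2) = (\<Sum>i<d. (w $ i)\<^sup>2)"
      by (rule sum.mono_neutral_left) (auto simp: I_def)
    also have "\<dots> = (euclid_norm w)\<^sup>2"
      using w by (simp add: euclid_norm_def L2_set_def sum_nonneg)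
    finally show ?thesis
      by simp
  qed
  then have "I \<noteq> {}"
    using w by auto
  \<comment> \<open>The summand 0 matches the form of \<open>normal_density_affine\<close>, used
    with shift 0 and scale \<open>w $ i\<close>.\<close>
  have "indep_vars (\<lambda>_. borel) (\<lambda>i z. 0 + w $ i * z i) I"
    using indep_vars_compose2[OF indep_vars_subset[OF std_gaussian_coordinates_indep[OF d] I(2)],
        of "\<lambda>i x. 0 + w $ i * x" "\<lambda>_. borel"] by simp
  moreover have "distributed (std_gaussian d) lborel (\<lambda>z. 0 + w $ i * z i)
      (normal_density 0 \<bar>w $ i\<bar>)" if "i \<in> I" for i
    using normal_density_affine[OF std_gaussian_coordinate_normal[of i d], of "w $ i" 0] that
    by (simp add: I_def)
  ultimately have "distributed (std_gaussian d) lborel (\<lambda>z. \<Sum>i\<in>I. 0 + w $ i * z i)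
      (normal_density (\<Sum>i\<in>I. 0) (sqrt (\<Sum>i\<in>I. \<bar>w $ i\<bar>\<^sup>2)))"
    using I \<open>I \<noteq> {}\<close> by (intro sum_indep_normal) (auto simp: I_def)
  moreover have "(\<Sum>i\<in>I. 0 + w $ i * z i) = vec d z \<bullet> w" for z
  proof -
    have "(\<Sum>i\<in>I. 0 + w $ i * z i) = (\<Sum>i<d. w $ i * z i)"
      by (rule sum.mono_neutral_cong_left) (auto simp: I_def)
    then show ?thesis
      using w by (simp add: scalar_prod_def atLeast0LessThan mult.commute)
  qed
  ultimately show ?thesis
    using w(2) unfolding sq by simp
qed

lemma std_gaussian_anticoncentration:
  assumes "0 < d" "w \<in> carrier_vec d" "0 \<le> \<eta>"
  shows "measure (std_gaussian d)
    {z \<in> space (std_gaussian d). \<bar>vec d z \<bullet> w\<bar> < \<eta> * euclid_norm w} \<le> \<eta>"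
proof (cases "euclid_norm w = 0")
  \<comment> \<open>The strict inequality makes the event empty when \<open>w\<close> has norm
    0.\<close>
  case True
  then show ?thesis
    using assms by simp
next
  case False
  interpret prob_space "std_gaussian d"
    by (rule prob_space_std_gaussian)
  have "0 < euclid_norm w"
    using False euclid_norm_nonneg[of w] by linarith
  then show ?thesis
    using assms by (intro normal_small_ball[where \<mu> = 0] std_gaussian_linear_combination)
qed

section \<open>Measurability of the estimate\<close>

text \<open>The type \<open>real vec\<close> contains vectors of every dimension, so measurability
  is stated coordinatewise within one fixed carrier.\<close>

definition vec_measurable :: "'a measure \<Rightarrow> nat \<Rightarrow> ('a \<Rightarrow> real vec) \<Rightarrow> bool" where
  "vec_measurable M d f \<longleftrightarrow>
     (\<forall>z. f z \<in> carrier_vec d) \<and> (\<forall>i<d. (\<lambda>z. f z $ i) \<in> borel_measurable M)"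

lemma vec_measurable_dim: "vec_measurable M d f \<Longrightarrow> dim_vec (f z) = d"
  unfolding vec_measurable_def by (blast dest: carrier_vecD)

lemma vec_measurable_index:
  "vec_measurable M d f \<Longrightarrow> i < d \<Longrightarrow> (\<lambda>z. f z $ i) \<in> borel_measurable M"
  unfolding vec_measurable_def by blast

lemma vec_measurable_euclid_norm:
  assumes "vec_measurable M d f"
  shows "(\<lambda>z. euclid_norm (f z)) \<in> borel_measurable M"
proof -
  have [measurable]: "(\<lambda>z. \<Sum>i<d. (f z $ i)\<^sup>2) \<in> borel_measurable M"
    by (intro borel_measurable_sum borel_measurable_power vec_measurable_index[OF assms]) simp
  have "(\<lambda>z. euclid_norm (f z)) = (\<lambda>z. sqrt (\<Sum>i<d. (f z $ i)\<^sup>2))"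
    by (simp add: euclid_norm_def L2_set_def vec_measurable_dim[OF assms])
  also have "\<dots> \<in> borel_measurable M"
    by measurable
  finally show ?thesis .
qed

lemma vec_measurable_normalized:
  assumes "vec_measurable M d f"
  shows "vec_measurable M d (\<lambda>z. normalized_vec (f z))"
  unfolding vec_measurable_def
proof (intro conjI allI impI)
  show "normalized_vec (f z) \<in> carrier_vec d" for z
    using assms by (simp add: vec_measurable_def normalized_vec_def)
  fix i assume i: "i < d"
  have "(\<lambda>z. normalized_vec (f z) $ i) = (\<lambda>z. 1 / euclid_norm (f z) * f z $ i)"
    using i by (simp add: normalized_vec_def vec_measurable_dim[OF assms])
  also have "\<dots> \<in> borel_measurable M"
    by (intro borel_measurable_times borel_measurable_divide borel_measurable_const
        vec_measurable_euclid_norm[OF assms] vec_measurable_index[OF assms i])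
  finally show "(\<lambda>z. normalized_vec (f z) $ i) \<in> borel_measurable M" .
qed

lemma vec_measurable_mult_mat_vec:
  assumes A: "A \<in> carrier_mat m d" and f: "vec_measurable M d f"
  shows "vec_measurable M m (\<lambda>z. A *\<^sub>v f z)"
  unfolding vec_measurable_def
proof (intro conjI allI impI)
  show "A *\<^sub>v f z \<in> carrier_vec m" for z
    using mult_mat_vec_carrier[OF A] f by (simp add: vec_measurable_def)
  fix i assume i: "i < m"
  have "(\<lambda>z. (A *\<^sub>v f z) $ i) = (\<lambda>z. \<Sum>j<d. row A i $ j * f z $ j)"
    using A i by (simp add: scalar_prod_def atLeast0LessThan vec_measurable_dim[OF f])
  also have "\<dots> \<in> borel_measurable M"
    by (intro borel_measurable_sum borel_measurable_times borel_measurable_const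
        vec_measurable_index[OF f]) simp
  finally show "(\<lambda>z. (A *\<^sub>v f z) $ i) \<in> borel_measurable M" .
qed

lemma vec_measurable_power_iter:
  assumes "X \<in> carrier_mat r d" "vec_measurable M d f"
  shows "vec_measurable M d (\<lambda>z. power_iter X (f z) n)"
proof (induction n)
  case (Suc n)
  show ?case
  proof (cases "X = 0\<^sub>m (dim_row X) (dim_col X)")
    case True
    have "(\<lambda>z. power_iter X (f z) (Suc n)) = f"
      by (simp only: power_iter.simps if_P[OF True])
    then show ?thesis
      using assms by simp
  next
    case False
    have "(\<lambda>z. power_iter X (f z) (Suc n))
        = (\<lambda>z. normalized_vec ((transpose_mat X * X) *\<^sub>v power_iter X (f z) n))"
      by (simp only: power_iter.simps if_not_P[OF False])
    then show ?thesis
      using Suc assms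
      by (auto intro!: vec_measurable_normalized vec_measurable_mult_mat_vec[of _ d d])
  qed
qed (use assms in simp)

lemma start_vec_eq_normalized: "start_vec d z = normalized_vec (vec d z)"
  by (rule eq_vecI) (simp_all add: start_vec_def normalized_vec_def euclid_norm_def L2_set_def)

text \<open>The final bound enlarges an event to the set of good starting points; monotonicity of
  the measure requires that larger set to be measurable.\<close>

lemma measurable_power_estimate:
  assumes "X \<in> carrier_mat r d"
  shows "(\<lambda>z. power_estimate X (start_vec d z) n) \<in> borel_measurable (std_gaussian d)"
proof -
  have "vec_measurable (std_gaussian d) d (\<lambda>z. vec d z)"
    by (simp add: vec_measurable_def std_gaussian_measurable_coordinate)
  then show ?thesis
    unfolding power_estimate_def start_vec_eq_normalized using assms
    by (intro vec_measurable_euclid_norm[of _ d] vec_measurable_mult_mat_vec[of _ d d]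
        vec_measurable_power_iter[of _ r] vec_measurable_normalized) auto
qed

section \<open>The probabilistic bound\<close>

lemma power_estimate_prob:
  assumes X: "X \<in> carrier_mat r d" and d: "0 < d" and \<delta>: "0 < \<delta>"
  shows "measure (std_gaussian d)
      {z \<in> space (std_gaussian d). power_estimate X (start_vec d z) n
        \<ge> (spectral_norm X)\<^sup>2 * (1 - \<epsilon>)
          / sqrt (1 + 12 * real d / \<delta> ^ 3 * (1 - \<epsilon>) ^ (2 * (n + 1)))}
    \<ge> 1 - \<delta>"
    (is "measure ?P ?good \<ge> _")
proof -
  interpret prob_space ?P
    by (rule prob_space_std_gaussian)
  interpret symmetric_mat "transpose_mat X * X" d
    by (rule symmetric_gram[OF X])
  note [measurable] = measurable_power_estimate[OF X] std_gaussian_measurable_coordinate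
  have good: "?good \<in> events"
    by measurable
  consider "spectral_norm X = 0" | "0 < spectral_norm X"
    using spectral_norm_nonneg[of X] by linarith
  then show ?thesis
  proof cases
    \<comment> \<open>The claimed lower bound is 0 here, and the estimate is a norm.\<close>
    case 1
    then have "?good = space ?P"
      by (auto simp: power_estimate_def euclid_norm_nonneg)
    then show ?thesis
      using \<delta> prob_space by simp
  next
    case 2
    \<comment> \<open>The root is chosen so that replacing the spectral norm by \<open>t\<close>
      costs exactly the factor 2/3 in the power \<open>4 * (n + 1)\<close>, independently of
      \<open>n\<close>.\<close>
    define \<theta> where "\<theta> = root (4 * (n + 1)) (2 / 3)"
    define t where "t = \<theta> * spectral_norm X"
    have \<theta>: "0 < \<theta>" "\<theta> < 1"
      by (auto simp: \<theta>_def)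
    have t: "0 < t" "t < spectral_norm X"
      using \<theta> 2 by (simp_all add: t_def)
    have t_pow: "t ^ (4 * (n + 1)) = 2 / 3 * spectral_norm X ^ (4 * (n + 1))"
      unfolding t_def \<theta>_def power_mult_distrib by (subst real_root_pow_pos2) auto
    obtain v where v: "v \<in> carrier_vec d" "euclid_norm v \<le> 1" "t < euclid_norm (X *\<^sub>v v)"
      using spectral_norm_witness[OF X t(2)] .
    define w where "w = iterate v (n + 1)"
    have w: "w \<in> carrier_vec d"
      unfolding w_def by (rule iterate_carrier[OF v(1)])
    define tail where "tail = {z \<in> space ?P. d / (\<delta> / 2) \<le> (\<Sum>i<d. (z i)\<^sup>2)}"
    define thin where "thin = {z \<in> space ?P. \<bar>vec d z \<bullet> w\<bar> < \<delta> / 2 * euclid_norm w}"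
    have "tail \<in> events"
      unfolding tail_def by measurable
    moreover have "thin \<in> events"
    proof -
      have "(\<lambda>z. vec d z \<bullet> w) = (\<lambda>z. \<Sum>i<d. z i * w $ i)"
        using w by (simp add: scalar_prod_def atLeast0LessThan)
      also have "\<dots> \<in> borel_measurable ?P"
        by measurable
      finally have [measurable]: "(\<lambda>z. vec d z \<bullet> w) \<in> borel_measurable ?P" .
      show ?thesis
        unfolding thin_def by measurable
    qed
    ultimately have events: "tail \<in> events" "thin \<in> events" .
    have "space ?P - (tail \<union> thin) \<subseteq> ?good"
    proof
      fix z
      assume z: "z \<in> space ?P - (tail \<union> thin)"
      have "(euclid_norm (vec d z))\<^sup>2 = (\<Sum>i<d. (z i)\<^sup>2)"
        by (simp add: euclid_norm_def L2_set_def sum_nonneg)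
      also have "\<dots> \<le> d / (\<delta> / 2)"
        using z by (auto simp: tail_def)
      finally have norm: "(euclid_norm (vec d z))\<^sup>2 \<le> d / (\<delta> / 2)" .
      have inner: "\<delta> / 2 * euclid_norm w \<le> \<bar>vec d z \<bullet> w\<bar>"
        using z by (auto simp: thin_def)
      \<comment> \<open>The constant arises as 3/2 * 2 * 4: the loss from \<open>t\<close>, the norm
        bound \<open>2 * d / \<delta>\<close>, and the squared threshold \<open>\<delta> / 2\<close>
        in the denominator.\<close>
      have const: "3 / 2 * (d / (\<delta> / 2)) / (\<delta> / 2)\<^sup>2 \<le> 12 * real d / \<delta> ^ 3"
        using \<delta> by (simp add: field_simps power2_eq_square power3_eq_cube)
      have "(spectral_norm X)\<^sup>2 * (1 - \<epsilon>) / sqrt (1 + 12 * real d / \<delta> ^ 3 * (1 - \<epsilon>) ^ (2 * (n + 1)))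
          \<le> power_estimate X (normalized_vec (vec d z)) n"
        using \<delta> by (intro power_estimate_ge[OF X 2 v(1,2) t(1) v(3) _ _ norm w_def _ inner const])
          (simp_all only: t_pow order.refl vec_carrier half_gt_zero)
      then show "z \<in> ?good"
        using z by (simp only: start_vec_eq_normalized mem_Collect_eq Diff_iff simp_thms)
    qed
    then have "prob (space ?P - (tail \<union> thin)) \<le> prob ?good"
      using good by (rule finite_measure_mono)
    moreover have "prob (space ?P - (tail \<union> thin)) = 1 - prob (tail \<union> thin)"
      using events by (intro prob_compl) auto
    moreover have "prob (tail \<union> thin) \<le> prob tail + prob thin"
      using events by (rule measure_Un_le)
    moreover have "prob tail \<le> \<delta> / 2"
      unfolding tail_def using d \<delta> by (intro std_gaussian_norm_tail) auto
    moreover have "prob thin \<le> \<delta> / 2"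
      unfolding thin_def using d w \<delta> by (intro std_gaussian_anticoncentration) auto
    ultimately show ?thesis
      by linarith
  qed
qed

theorem lemma4:
  shows "\<exists>c::real. 0 < c \<and> c \<le> (2 / pi + 2) ^ 3 \<and>
    (\<forall>(r::nat) (d::nat) (X::real mat) (\<epsilon>::real) (\<delta>::real) (n::nat).
       0 < r \<longrightarrow> 0 < d \<longrightarrow> X \<in> carrier_mat r d \<longrightarrow> 0 < \<epsilon> \<longrightarrow> 0 < \<delta> \<longrightarrow> \<delta> < 1 \<longrightarrow> 1 \<le> n \<longrightarrow>
       measure (std_gaussian d)
         {z \<in> space (std_gaussian d).
            power_estimate X (start_vec d z) n
              \<ge> (spectral_norm X)\<^sup>2 * (1 - \<epsilon>)
                  / sqrt (1 + c * real d / \<delta> ^ 3 * (1 - \<epsilon>) ^ (2 * (n + 1)))}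
         \<ge> 1 - \<delta>)"
proof (intro exI[of _ 12] conjI allI impI)
  \<comment> \<open>The crude bound \<open>pi < 4\<close> suffices, since (5/2)^3 = 15.625 exceeds
    12.\<close>
  have "1 / 2 \<le> 2 / pi"
    using pi_less_4 by (simp add: field_simps)
  then have "(5 / 2) ^ 3 \<le> (2 / pi + 2) ^ 3"
    by (intro power_mono) auto
  then show "12 \<le> (2 / pi + 2) ^ 3"
    by (simp add: power3_eq_cube)
qed (use power_estimate_prob in auto)

end
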